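(* Let $h \in \mathbb{N}$ and let $w, w' \in \mathcal{W}_h$. Let $v = \textsc{Canonicalise}(w)$ and $v' = \textsc{Canonicalise}(w')$. Then (i) $v$ is functionally equivalent to $w$; and (ii) if $w$ and $w'$ are functionally equivalent, then $v = v'$.
   Context: For $h \in \mathbb{N}$ (including $h=0$) let $\mathcal{W}_h = \mathbb{R}^{3h+1}$, with elements (parameters) written $w = (a_1,b_1,c_1,\ldots,a_h,b_h,c_h,d)$, where $a_i,b_i,c_i,d\in\mathbb{R}$; the triple $(a_i,b_i,c_i)$ is called (hidden) unit $i$. Each $w\in\mathcal{W}_h$ defines $f_w:\mathbb{R}\to\mathbb{R}$ by $f_w(x) = d + \sum_{i=1}^h a_i\tanh(b_i x + c_i)$. Parameters $w\in\mathcal{W}_h$, $w'\in\mathcal{W}_{h'}$ are functionally equivalent if $f_w(x)=f_{w'}(x)$ for all $x\in\mathbb{R}$. The procedure $\textsc{Canonicalise}$ takes $w=(a_1,b_1,c_1,\ldots,a_h,b_h,c_h,d) \in \mathcal{W}_h$, modifies its components, and returns the resulting element of $\mathcal{W}_h$, as follows. Stage 1 (reduction). Set $Z \gets \emptyset$. While at least one of the following four conditions holds, perform the action of the first condition in the list that holds (for some choice of units witnessing it): (1) if for some unit $i\notin Z$, $a_i=0$: set $b_i,c_i\gets 0$ and $Z\gets Z\cup\{i\}$; (2) else if for some unit $i\notin Z$, $b_i=0$: set $d\gets d+a_i\tanh(c_i)$, then $a_i,c_i\gets 0$, and $Z\gets Z\cup\{i\}$; (3) else if for some units $i,j\notin Z$,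 $i\ne j$, $(b_i,c_i)=(b_j,c_j)$: set $a_j\gets a_j+a_i$, then $a_i,b_i,c_i\gets 0$, and $Z\gets Z\cup\{i\}$; (4) else if for some units $i,j\notin Z$, $i\neq j$, $(b_i,c_i)=(-b_j,-c_j)$: set $a_j\gets a_j-a_i$, then $a_i,b_i,c_i\gets 0$, and $Z\gets Z\cup\{i\}$. Stage 2 (negation). For each unit $i\notin Z$, set $(a_i,b_i,c_i)\gets \operatorname{sign}(b_i)\cdot(a_i,b_i,c_i)$. Stage 3 (sorting). Let $\pi$ be a permutation of $\{1,\ldots,h\}$ sorting the units by decreasing $b_i$, breaking ties by decreasing $c_i$. Set $w\gets(a_{\pi(1)},b_{\pi(1)},c_{\pi(1)},\ldots,a_{\pi(h)},b_{\pi(h)},c_{\pi(h)},d)$ and return $w$. $\textsc{Canonicalise}(w)$ denotes the output of an execution of this procedure on $w$; the procedure does not prescribe which witnessing units are picked in Stage 1 or which sorting permutation is picked in Stage 3. *)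

theory Defs
  imports Complex_Main "HOL-Combinatorics.Permutations"
begin

(* A parameter (a_1, b_1, c_1, ..., a_h, b_h, c_h, d) is the pair of the list of its units
   (a_i, b_i, c_i) and d.  Unit number i of the mathematical text is entry i - 1 of the list. *)

type_synonym hidden_unit = "real \<times> real \<times> real"
type_synonym param = "hidden_unit list \<times> real"

definition params :: "nat \<Rightarrow> param set" where
  "params h = {w. length (fst w) = h}"

definition net :: "param \<Rightarrow> real \<Rightarrow> real" where
  "net w x = snd w + (\<Sum>(a, b, c)\<leftarrow>fst w. a * tanh (b * x + c))"

definition functionally_equivalent :: "param \<Rightarrow> param \<Rightarrow> bool" where
  "functionally_equivalent w w' \<longleftrightarrow> (\<forall>x. net w x = net w' x)"


section \<open>Stage 1: reduction\<close>

(* A state (us, d, Z) consists of the current components of w and the set Z. *)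

type_synonym state = "hidden_unit list \<times> real \<times> nat set"

definition active :: "state \<Rightarrow> nat \<Rightarrow> bool" where
  "active = (\<lambda>(us, d, Z) i. i < length us \<and> i \<notin> Z)"

definition cond1 :: "state \<Rightarrow> nat \<Rightarrow> bool" where
  "cond1 s i \<longleftrightarrow> active s i \<and> (\<exists>b c. fst s ! i = (0, b, c))"

definition cond2 :: "state \<Rightarrow> nat \<Rightarrow> bool" where
  "cond2 s i \<longleftrightarrow> active s i \<and> (\<exists>a c. fst s ! i = (a, 0, c))"

definition cond3 :: "state \<Rightarrow> nat \<Rightarrow> nat \<Rightarrow> bool" where
  "cond3 s i j \<longleftrightarrow> active s i \<and> active s j \<and> i \<noteq> j \<and>
     (\<exists>a a' b c. fst s ! i = (a, b, c) \<and> fst s ! j = (a', b, c))"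

definition cond4 :: "state \<Rightarrow> nat \<Rightarrow> nat \<Rightarrow> bool" where
  "cond4 s i j \<longleftrightarrow> active s i \<and> active s j \<and> i \<noteq> j \<and>
     (\<exists>a a' b c. fst s ! i = (a, - b, - c) \<and> fst s ! j = (a', b, c))"

inductive reduce_step :: "state \<Rightarrow> state \<Rightarrow> bool" where
  step1: "cond1 (us, d, Z) i \<Longrightarrow> us ! i = (a, b, c) \<Longrightarrow>
     reduce_step (us, d, Z) (us[i := (a, 0, 0)], d, insert i Z)"
| step2: "(\<nexists>k. cond1 (us, d, Z) k) \<Longrightarrow>
     cond2 (us, d, Z) i \<Longrightarrow> us ! i = (a, b, c) \<Longrightarrow>
     reduce_step (us, d, Z) (us[i := (0, b, 0)], d + a * tanh c, insert i Z)"
| step3: "(\<nexists>k. cond1 (us, d, Z) k) \<Longrightarrow> (\<nexists>k. cond2 (us, d, Z) k) \<Longrightarrow>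
     cond3 (us, d, Z) i j \<Longrightarrow> us ! i = (a, b, c) \<Longrightarrow> us ! j = (a', b', c') \<Longrightarrow>
     reduce_step (us, d, Z) (us[j := (a' + a, b', c'), i := (0, 0, 0)], d, insert i Z)"
| step4: "(\<nexists>k. cond1 (us, d, Z) k) \<Longrightarrow> (\<nexists>k. cond2 (us, d, Z) k) \<Longrightarrow>
     (\<nexists>k l. cond3 (us, d, Z) k l) \<Longrightarrow>
     cond4 (us, d, Z) i j \<Longrightarrow> us ! i = (a, b, c) \<Longrightarrow> us ! j = (a', b', c') \<Longrightarrow>
     reduce_step (us, d, Z) (us[j := (a' - a, b', c'), i := (0, 0, 0)], d, insert i Z)"

definition reduced :: "state \<Rightarrow> bool" where
  "reduced s \<longleftrightarrow> (\<nexists>i. cond1 s i) \<and> (\<nexists>i. cond2 s i) \<and> (\<nexists>i j. cond3 s i j) \<and> (\<nexists>i j. cond4 s i j)"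

definition reduction :: "param \<Rightarrow> state \<Rightarrow> bool" where
  "reduction w s \<longleftrightarrow> reduce_step\<^sup>*\<^sup>* (fst w, snd w, {}) s \<and> reduced s"


section \<open>Stage 2: negation\<close>

definition negation :: "state \<Rightarrow> param" where
  "negation = (\<lambda>(us, d, Z).
     (map (\<lambda>i. if i \<in> Z then us ! i
               else (case us ! i of (a, b, c) \<Rightarrow> (sgn b * a, sgn b * b, sgn b * c)))
        [0..<length us], d))"


section \<open>Stage 3: sorting\<close>

definition unit_ge :: "hidden_unit \<Rightarrow> hidden_unit \<Rightarrow> bool" where
  "unit_ge = (\<lambda>(a, b, c) (a', b', c'). b > b' \<or> b = b' \<and> c \<ge> c')"

definition sorting :: "param \<Rightarrow> param \<Rightarrow> bool" where
  "sorting w v \<longleftrightarrow> (\<exists>\<pi>. \<pi> permutes {..<length (fst w)} \<and>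
     (\<forall>i j. i < j \<and> j < length (fst w) \<longrightarrow> unit_ge (fst w ! \<pi> i) (fst w ! \<pi> j)) \<and>
     v = (map (\<lambda>i. fst w ! \<pi> i) [0..<length (fst w)], snd w))"


section \<open>The procedure\<close>

(* canonicalise w v: some execution on w, with any choice of the witnessing units and of the
   sorting permutation, returns v. *)

definition canonicalise :: "param \<Rightarrow> param \<Rightarrow> bool" where
  "canonicalise w v \<longleftrightarrow> (\<exists>s. reduction w s \<and> sorting (negation s) v)"


section \<open>The procedure always terminates and returns a parameter of the same size\<close>

lemma not_reduced_imp_step:
  assumes "\<not> reduced s" shows "\<exists>s'. reduce_step s s'"
proof (cases s)
  case (fields us d Z)
  show ?thesis
    using assms unfolding reduced_def fields
    by (metis reduce_step.intros prod_cases3)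
qed

lemma reduce_step_measure:
  assumes "reduce_step s s'"
  shows "length (fst s') = length (fst s)"
    and "card {i. active s' i} < card {i. active s i}"
proof -
  show "length (fst s') = length (fst s)"
    using assms by cases auto
  have "\<exists>i. active s i \<and> {k. active s' k} = {k. active s k} - {i}"
    using assms
    by cases (auto simp: active_def cond1_def cond2_def cond3_def cond4_def)
  moreover have "finite {i. active s i}"
    by (rule finite_subset[of _ "{..<length (fst s)}"]) (auto simp: active_def)
  ultimately show "card {i. active s' i} < card {i. active s i}"
    by (metis (mono_tags, lifting) card_Diff1_less mem_Collect_eq)
qed

lemma reduce_step_terminates: "wfp reduce_step\<inverse>\<inverse>"
  by (rule wfp_if_convertible_to_nat[of _ "\<lambda>s. card {i. active s i}"])
    (auto dest: reduce_step_measure(2))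

lemma reduction_exists: "\<exists>s. reduction w s"
proof -
  have "\<exists>s'. reduce_step\<^sup>*\<^sup>* s s' \<and> reduced s'" for s
    using reduce_step_terminates
  proof (induction s rule: wfp_induct_rule)
    case (less s)
    then show ?case
      by (metis conversepI converse_rtranclp_into_rtranclp not_reduced_imp_step rtranclp.rtrancl_refl)
  qed
  then show ?thesis
    unfolding reduction_def by blast
qed

lemma sorting_exists: "\<exists>v. sorting w v"
proof -
  let ?us = "fst w" and ?n = "length (fst w)"
  have tot: "unit_ge x y \<or> unit_ge y x" and tr: "unit_ge x y \<Longrightarrow> unit_ge y z \<Longrightarrow> unit_ge x z" for x y z
    by (auto simp: unit_ge_def split: prod.splits)
  have "\<exists>xs. mset xs = mset ys \<and> sorted_wrt unit_ge xs" for ys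
  proof (induction ys)
    case (Cons y ys)
    then obtain xs where xs: "mset xs = mset ys" "sorted_wrt unit_ge xs" by blast
    let ?zs = "filter (\<lambda>x. unit_ge x y) xs @ y # filter (\<lambda>x. \<not> unit_ge x y) xs"
    have "mset ?zs = mset (y # ys)"
      using xs(1) by (simp add: mset_filter multiset_partition[symmetric])
    moreover have "sorted_wrt unit_ge ?zs"
      unfolding sorted_wrt_append sorted_wrt.simps set_append list.set set_filter
      using sorted_wrt_filter[OF xs(2)] by (auto simp del: split_paired_All) (metis tot tr)+
    ultimately show ?case by blast
  qed simp
  then obtain xs where xs: "mset xs = mset ?us" "sorted_wrt unit_ge xs" by blast
  then obtain \<pi> where p: "\<pi> permutes {..<?n}" "permute_list \<pi> ?us = xs"
    by (metis mset_eq_permutation)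
  show ?thesis
    unfolding sorting_def
  proof (intro exI conjI)
    show "\<forall>i j. i < j \<and> j < ?n \<longrightarrow> unit_ge (?us ! \<pi> i) (?us ! \<pi> j)"
      using xs(2) p by (auto simp: sorted_wrt_iff_nth_less permute_list_def)
  qed (use p in auto)
qed

lemma canonicalise_exists: "\<exists>v. canonicalise w v"
  unfolding canonicalise_def using reduction_exists sorting_exists by blast

lemma canonicalise_params:
  assumes "w \<in> params h" "canonicalise w v"
  shows "v \<in> params h"
proof -
  have "length (fst s') = length (fst s)" if "reduce_step\<^sup>*\<^sup>* s s'" for s s'
    using that by induction (auto dest: reduce_step_measure(1))
  then show ?thesis
    using assms
    by (fastforce simp: params_def canonicalise_def reduction_def sorting_def negation_def)
qed

end

theory Submission
  imports "HOL-Complex_Analysis.Conformal_Mappings" Defs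
begin

text \<open>Every step of the procedure preserves the function, and its output is sorted and consists of
  zero units and of units with \<open>a \<noteq> 0\<close>, \<open>b > 0\<close> and pairwise distinct \<open>(b, c)\<close>. By the linear
  independence of \<open>1\<close> and the functions \<open>tanh (b x + c)\<close> with \<open>b > 0\<close>, the function determines the
  nonzero units, and then the length determines the number of zero units.\<close>

section \<open>Hyperbolic functions of a complex argument\<close>

lemma tanh_of_real_complex: "tanh (complex_of_real x) = of_real (tanh x)"
  by (simp add: tanh_def sinh_field_def cosh_field_def exp_of_real flip: of_real_minus)

lemma Re_cosh: "Re (cosh z) = cosh (Re z) * cos (Im z)"
  by (simp add: cosh_conv_cos Re_cos cosh_field_def field_simps)

lemma Im_cosh: "Im (cosh z) = sinh (Re z) * sin (Im z)"
  by (simp add: cosh_conv_cos Im_cos sinh_field_def field_simps)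

text \<open>The real part \<open>cosh (Re z) * cos (Im z)\<close> is positive there.\<close>

lemma cosh_nonzero_strip:
  assumes "\<bar>Im z\<bar> < pi / 2"
  shows "cosh z \<noteq> (0 :: complex)"
proof -
  have "cos (Im z) > 0"
    using assms by (intro cos_gt_zero_pi) auto
  then have "Re (cosh z) \<noteq> 0"
    by (simp add: Re_cosh)
  then show ?thesis by auto
qed

text \<open>On this line \<open>sin (Im z) = 1\<close>, so the imaginary part is
  \<open>sinh (Re z)\<close>, which vanishes only at \<open>Re z = 0\<close>.\<close>

lemma cosh_nonzero_boundary:
  assumes "Im z = pi / 2" "Re z \<noteq> 0"
  shows "cosh z \<noteq> (0 :: complex)"
proof -
  have "Im (cosh z) \<noteq> 0"
    unfolding Im_cosh assms(1) using assms(2) by simp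
  then show ?thesis by auto
qed

section \<open>Linear independence of shifted and scaled tanh functions\<close>

text \<open>Among the units with the largest \<open>b\<close>, pick one, \<open>tanh (b\<^sub>0 x + c\<^sub>0)\<close>. The sum continues
  holomorphically to the strip \<open>\<bar>Im z\<bar> < \<pi> / (2 b\<^sub>0)\<close>, where it vanishes identically. At the boundary
  point \<open>z\<^sub>0 = (\<i> \<pi> / 2 - c\<^sub>0) / b\<^sub>0\<close> only the chosen unit has a pole, so its coefficient is zero.\<close>
lemma tanh_units_independent:
  fixes A :: "(real \<times> real) set" and \<alpha> :: "real \<times> real \<Rightarrow> real"
  assumes fin: "finite A" and pos: "\<And>p. p \<in> A \<Longrightarrow> fst p > 0"
    and zero: "\<And>x. d + (\<Sum>p\<in>A. \<alpha> p * tanh (fst p * x + snd p)) = 0"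
    and pA: "p \<in> A"
  shows "\<alpha> p = 0"
proof (rule ccontr)
  assume nz: "\<alpha> p \<noteq> 0"
  \<comment> \<open>Dropping the zero coefficients first ensures that the unit with the largest
    \<open>b\<close> has a nonzero coefficient, which the pole will contradict.\<close>
  define B where "B = {p \<in> A. \<alpha> p \<noteq> 0}"
  have finB: "finite B" using fin by (simp add: B_def)
  have neB: "B \<noteq> {}" using pA nz unfolding B_def by blast
  have "Max (fst ` B) \<in> fst ` B" using finB neB by simp
  then obtain p0 where "p0 \<in> B" "fst p0 = Max (fst ` B)" by auto
  with finB have p0: "p0 \<in> B" "\<And>p. p \<in> B \<Longrightarrow> fst p \<le> fst p0" by simp_all
  define b0 c0 where "b0 = fst p0" and "c0 = snd p0"
  have b0: "b0 > 0" using p0(1) pos by (auto simp: B_def b0_def)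
  define L where "L = (\<lambda>p z. complex_of_real (fst p) * z + of_real (snd p))"
  define R where "R = (\<lambda>z. of_real d + (\<Sum>p\<in>B - {p0}. of_real (\<alpha> p) * tanh (L p z)))"
  define S where "S = {z. \<bar>Im z\<bar> < pi / (2 * b0)}"
  have S_eq: "S = {z. Im z < pi / (2 * b0)} \<inter> {z. Im z > - (pi / (2 * b0))}"
    by (auto simp: S_def abs_if)
  have openS: "open S"
    unfolding S_eq by (intro open_Int open_halfspace_Im_lt open_halfspace_Im_gt)
  have "convex S"
    unfolding S_eq by (intro convex_Int convex_halfspace_Im_lt convex_halfspace_Im_gt)
  then have connS: "connected S" by (rule convex_connected)
  \<comment> \<open>As \<open>b0\<close> is the largest slope, every \<open>L p\<close> maps
    \<open>S\<close> into the strip of half-width \<open>pi / 2\<close>.\<close>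
  have Lc: "cosh (L p z) \<noteq> 0" if "p \<in> B" "z \<in> S" for p z
  proof (rule cosh_nonzero_strip)
    have "fst p > 0" "fst p \<le> b0" using that p0 pos by (auto simp: B_def b0_def)
    then have "\<bar>Im (L p z)\<bar> \<le> b0 * \<bar>Im z\<bar>"
      by (simp add: L_def abs_mult mult_right_mono)
    also have "\<dots> < pi / 2"
      using that(2) b0 by (simp add: S_def field_simps)
    finally show "\<bar>Im (L p z)\<bar> < pi / 2" .
  qed
  define F where "F = (\<lambda>z. of_real d + (\<Sum>p\<in>B. of_real (\<alpha> p) * tanh (L p z)))"
  have F_split: "F z = of_real (\<alpha> p0) * tanh (L p0 z) + R z" for z
    using finB p0(1) by (simp add: F_def R_def sum.remove)
  have diffL: "(\<lambda>z. tanh (L p z)) field_differentiable at z within T" if "cosh (L p z) \<noteq> 0" for p z T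
    using that unfolding L_def field_differentiable_def
    by (auto intro!: exI derivative_eq_intros)
  have holF: "F holomorphic_on S"
  proof -
    have "(\<lambda>z. tanh (L p z)) holomorphic_on S" if "p \<in> B" for p
      unfolding holomorphic_on_def using diffL Lc[OF that] by blast
    then show ?thesis unfolding F_def by (intro holomorphic_intros)
  qed
  have F_real: "F (of_real x) = 0" for x
  proof -
    have "F (of_real x) = of_real (d + (\<Sum>p\<in>B. \<alpha> p * tanh (fst p * x + snd p)))"
      by (simp add: F_def L_def flip: tanh_of_real_complex)
    also have "(\<Sum>p\<in>B. \<alpha> p * tanh (fst p * x + snd p)) = (\<Sum>p\<in>A. \<alpha> p * tanh (fst p * x + snd p))"
      using fin by (intro sum.mono_neutral_left) (auto simp: B_def)
    finally show ?thesis using zero by simp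
  qed
  \<comment> \<open>Identity theorem: \<open>F\<close> vanishes on the real axis, which lies in
    \<open>S\<close> and accumulates at 0.\<close>
  have F_zero: "F z = 0" if "z \<in> S" for z
  proof (rule analytic_continuation[OF holF openS connS, of "of_real ` UNIV" 0])
    show "0 islimpt range complex_of_real"
      unfolding islimpt_approachable
    proof (intro allI impI)
      fix e :: real assume "e > 0"
      then show "\<exists>x'\<in>range complex_of_real. x' \<noteq> 0 \<and> dist x' 0 < e"
        by (intro bexI[OF _ rangeI[of _ "e / 2"]]) (auto simp: norm_divide)
    qed
  qed (use that b0 F_real in \<open>auto simp: S_def\<close>)
  define z0 where "z0 = (\<i> * of_real (pi / 2) - of_real c0) / complex_of_real b0"
  have L0: "L p0 z0 = \<i> * of_real (pi / 2)"
    using b0 by (simp add: L_def z0_def b0_def c0_def)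
  have Im_z0: "Im z0 = pi / (2 * b0)" and Re_z0: "Re z0 = - c0 / b0"
    using b0 by (simp_all add: z0_def)
  \<comment> \<open>With the same slope, a different shift moves \<open>L p z0\<close> along the
    line \<open>Im = pi / 2\<close> away from the zero of \<open>cosh\<close>; a smaller slope keeps
    it inside the strip.\<close>
  have cosh_z0: "cosh (L p z0) \<noteq> 0" if "p \<in> B - {p0}" for p
  proof (cases "fst p = b0")
    case True
    then have "snd p \<noteq> c0" using that by (auto simp: b0_def c0_def prod_eq_iff)
    with True b0 show ?thesis
      by (intro cosh_nonzero_boundary) (auto simp: L_def Im_z0 Re_z0)
  next
    case False
    then have "fst p < b0" using that p0(2)[of p] by (simp add: b0_def)
    moreover have "fst p > 0" using that by (intro pos) (simp add: B_def)
    ultimately have "\<bar>Im (L p z0)\<bar> < pi / 2"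
      using b0 by (simp add: L_def Im_z0 field_simps)
    then show ?thesis by (rule cosh_nonzero_strip)
  qed
  \<comment> \<open>Multiplying \<open>F\<close> by \<open>cosh (L p0 z)\<close> clears the pole, so
    \<open>G\<close> is continuous at \<open>z0\<close> even though \<open>F\<close> is singular
    there.\<close>
  define G where "G = (\<lambda>z. of_real (\<alpha> p0) * sinh (L p0 z) + cosh (L p0 z) * R z)"
  have G_zero: "G z = 0" if "z \<in> S" for z
  proof -
    have "G z = cosh (L p0 z) * F z"
      using Lc[OF p0(1) that] by (simp add: G_def F_split tanh_def field_simps)
    then show ?thesis using F_zero[OF that] by simp
  qed
  have contR: "isCont R z0"
    unfolding R_def
    by (intro continuous_intros field_differentiable_imp_continuous_at diffL cosh_z0)
  have contG: "isCont G z0"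
    unfolding G_def L_def by (intro continuous_intros contR)
  \<comment> \<open>\<open>z0\<close> lies on the upper edge of \<open>S\<close> and is approached
    vertically from below; the strip has width \<open>pi / b0\<close>, so for \<open>t\<close> below
    this bound the points stay in \<open>S\<close>.\<close>
  have "((\<lambda>t. z0 - \<i> * complex_of_real t) \<longlongrightarrow> z0 - \<i> * of_real 0) (at_right 0)"
    by (intro tendsto_intros)
  then have "((\<lambda>t. G (z0 - \<i> * complex_of_real t)) \<longlongrightarrow> G z0) (at_right 0)"
    by (intro isCont_tendsto_compose[OF contG]) simp
  moreover have "\<forall>\<^sub>F t in at_right 0. G (z0 - \<i> * complex_of_real t) = 0"
  proof (rule eventually_at_rightI[of _ "pi / b0"])
    fix t :: real assume "t \<in> {0<..<pi / b0}"
    then show "G (z0 - \<i> * complex_of_real t) = 0"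
      using b0 by (intro G_zero) (auto simp: S_def Im_z0 abs_if field_simps)
  qed (use b0 in simp)
  ultimately have "((\<lambda>_. 0) \<longlongrightarrow> G z0) (at_right (0 :: real))"
    using tendsto_cong by fast
  then have "G z0 = 0" by (simp add: tendsto_const_iff)
  moreover have "cosh (L p0 z0) = 0" "sinh (L p0 z0) = \<i>"
  proof -
    have "\<i> * L p0 z0 = of_real (- (pi / 2))" by (simp add: L0)
    then show "cosh (L p0 z0) = 0" "sinh (L p0 z0) = \<i>"
      by (simp_all only: cosh_conv_cos sinh_conv_sin cos_of_real sin_of_real) simp_all
  qed
  ultimately have "\<alpha> p0 = 0" by (simp add: G_def)
  with p0(1) show False by (simp add: B_def)
qed

section \<open>Uniqueness of the units of a function\<close>

definition unit_fun :: "real \<Rightarrow> hidden_unit \<Rightarrow> real" where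
  "unit_fun x = (\<lambda>(a, b, c). a * tanh (b * x + c))"

lemma net_eq: "net (us, d) x = d + sum_list (map (unit_fun x) us)"
  by (simp add: net_def unit_fun_def)

lemma unit_fun_zero: "unit_fun x (0, 0, 0) = 0"
  by (simp add: unit_fun_def)

lemma unit_fun_add: "unit_fun x (a + a', b, c) = unit_fun x (a, b, c) + unit_fun x (a', b, c)"
  by (simp add: unit_fun_def distrib_right)

text \<open>Oddness of tanh; it justifies both the merge under condition (4) and the sign change of
  Stage 2.\<close>

lemma unit_fun_uminus: "unit_fun x (- a, - b, - c) = unit_fun x (a, b, c)"
proof -
  have "- b * x + - c = - (b * x + c)" by simp
  then show ?thesis unfolding unit_fun_def by (simp only: prod.case tanh_minus minus_mult_minus)
qed

text \<open>Units are grouped by their pair \<open>(b, c)\<close>. Pairs in \<open>P\<close> without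
  a unit get coefficient 0, so two sets of units can be written over one common index set.\<close>

lemma sum_unit_fun_eq:
  assumes "finite U" "finite P" "snd ` U \<subseteq> P"
  shows "(\<Sum>u\<in>U. unit_fun x u) = (\<Sum>p\<in>P. (\<Sum>u | u \<in> U \<and> snd u = p. fst u) * tanh (fst p * x + snd p))"
proof -
  have "(\<Sum>u\<in>U. unit_fun x u) = (\<Sum>p\<in>P. \<Sum>u | u \<in> U \<and> snd u = p. unit_fun x u)"
    by (rule sum.group[symmetric]) (use assms in auto)
  also have "\<dots> = (\<Sum>p\<in>P. (\<Sum>u | u \<in> U \<and> snd u = p. fst u) * tanh (fst p * x + snd p))"
    by (intro sum.cong refl) (auto simp: sum_distrib_right unit_fun_def intro!: sum.cong)
  finally show ?thesis .
qed

text \<open>Over the common index set \<open>?P\<close>, independence forces the coefficients of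
  \<open>U\<close> and \<open>V\<close> to agree. Injectivity of \<open>snd\<close> makes the
  coefficient at a unit's pair its own \<open>a\<close>; as this is nonzero, the other set has a
  unit with the same pair and the same \<open>a\<close>.\<close>

lemma units_unique:
  fixes U V :: "hidden_unit set"
  assumes fin: "finite U" "finite V" and inj: "inj_on snd U" "inj_on snd V"
    and pos: "\<And>a b c. (a, b, c) \<in> U \<union> V \<Longrightarrow> a \<noteq> 0 \<and> b > 0"
    and eq: "\<And>x. d + (\<Sum>u\<in>U. unit_fun x u) = e + (\<Sum>u\<in>V. unit_fun x u)"
  shows "U = V"
proof -
  define coef where "coef = (\<lambda>(W :: hidden_unit set) p. \<Sum>u | u \<in> W \<and> snd u = p. fst u)"
  have coef_mem: "coef W (snd u) = fst u" if "inj_on snd W" "u \<in> W" for W u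
  proof -
    have "{v \<in> W. snd v = snd u} = {u}" using that unfolding inj_on_def by blast
    then show ?thesis by (simp add: coef_def)
  qed
  have coef_nz: "\<exists>u\<in>W. snd u = p" if "coef W p \<noteq> 0" for W p
    using that unfolding coef_def by (metis (mono_tags, lifting) mem_Collect_eq sum.not_neutral_contains_not_neutral)
  let ?P = "snd ` (U \<union> V)"
  have same: "coef U p = coef V p" if "p \<in> ?P" for p
  proof -
    have "coef U p - coef V p = 0"
    proof (rule tanh_units_independent[where A = ?P and d = "d - e" and \<alpha> = "\<lambda>p. coef U p - coef V p"])
      fix x
      show "d - e + (\<Sum>p\<in>?P. (coef U p - coef V p) * tanh (fst p * x + snd p)) = 0"
      proof -
        have "(\<Sum>u\<in>W. unit_fun x u) = (\<Sum>p\<in>?P. coef W p * tanh (fst p * x + snd p))"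
          if "W \<subseteq> U \<union> V" for W
          unfolding coef_def using that fin by (intro sum_unit_fun_eq) (auto intro: finite_subset)
        from this[of U] this[of V] eq[of x] show ?thesis
          by (simp add: left_diff_distrib sum_subtractf)
      qed
    next
      show "fst q > 0" if "q \<in> ?P" for q
        using that pos by fastforce
    qed (use fin that in simp_all)
    then show ?thesis by simp
  qed
  have sub: "W \<subseteq> W'" if W: "inj_on snd W" "inj_on snd W'" "W \<subseteq> U \<union> V"
    and c: "\<And>p. p \<in> ?P \<Longrightarrow> coef W p = coef W' p" for W W'
  proof
    fix u assume u: "u \<in> W"
    then have "fst u \<noteq> 0" using pos W(3) by (cases u) auto
    moreover have fu: "fst u = coef W' (snd u)"
      using coef_mem[OF W(1) u] c[of "snd u"] u W(3) by auto
    ultimately obtain v where v: "v \<in> W'" "snd v = snd u" using coef_nz by metis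
    with fu coef_mem[OF W(2) v(1)] have "u = v" by (simp add: prod_eq_iff)
    with v show "u \<in> W'" by simp
  qed
  have "U \<subseteq> V" by (rule sub) (use inj same in auto)
  moreover have "V \<subseteq> U" by (rule sub) (use inj same in auto)
  ultimately show ?thesis by blast
qed

section \<open>Stage 1: invariants of the reduction\<close>

lemma sum_list_list_update:
  fixes xs :: "'a::ab_group_add list"
  assumes "k < length xs"
  shows "sum_list (xs[k := x]) = sum_list xs - xs ! k + x"
  using assms by (induction xs arbitrary: k) (auto split: nat.split simp: algebra_simps)

lemma reduce_step_net:
  assumes "reduce_step (us, d, Z) (us', d', Z')"
  shows "net (us', d') = net (us, d)"
proof
  fix x show "net (us', d') x = net (us, d) x"
    using assms
  proof cases
    case (step1 i a b c)
    then have "i < length us" "a = 0"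
      by (auto simp: cond1_def active_def)
    with step1 show ?thesis
      by (simp add: net_eq map_update sum_list_list_update unit_fun_def)
  next
    case (step2 i a b c)
    then have "i < length us" "b = 0"
      by (auto simp: cond2_def active_def)
    with step2 show ?thesis
      by (simp add: net_eq map_update sum_list_list_update unit_fun_def)
  next
    case (step3 i j a b c a' b' c')
    then have "i < length us" "j < length us" "i \<noteq> j" "b' = b" "c' = c"
      by (auto simp: cond3_def active_def)
    with step3 show ?thesis
      by (simp add: net_eq map_update sum_list_list_update unit_fun_zero unit_fun_add)
  next
    case (step4 i j a b c a' b' c')
    then have ij: "i < length us" "j < length us" "i \<noteq> j" "b = - b'" "c = - c'"
      by (auto simp: cond4_def active_def)
    \<comment> \<open>Subtracting \<open>a\<close> adds the unit \<open>(- a, b', c')\<close>, which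
      by oddness is the same function as the unit \<open>(a, b, c)\<close> being removed.\<close>
    have "unit_fun x (a' - a, b', c') = unit_fun x (a', b', c') + unit_fun x (a, b, c)"
      using unit_fun_add[of x a' "- a" b' c'] unit_fun_uminus[of x "- a" b' c'] ij(4,5) by simp
    with step4 ij(1-3) show ?thesis
      by (simp add: net_eq map_update sum_list_list_update unit_fun_zero)
  qed
qed

definition zeroed :: "state \<Rightarrow> bool" where
  "zeroed = (\<lambda>(us, d, Z). \<forall>i<length us. i \<in> Z \<longrightarrow> us ! i = (0, 0, 0))"

text \<open>Any component of unit \<open>i\<close> that an action does not overwrite by 0 is already
  0 by its condition. The partner \<open>j\<close> of a merge lies outside the new \<open>Z\<close>,
  so changing it does no harm.\<close>

lemma reduce_step_zeroed:
  assumes "reduce_step s s'" "zeroed s"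
  shows "zeroed s'"
  using assms(1)
proof cases
  case (step1 us d Z i a b c)
  then have "a = 0" "i < length us" by (simp_all add: cond1_def active_def)
  with step1 assms(2) show ?thesis by (simp add: zeroed_def nth_list_update)
next
  case (step2 us d Z i a b c)
  then have "b = 0" "i < length us" by (simp_all add: cond2_def active_def)
  with step2 assms(2) show ?thesis by (simp add: zeroed_def nth_list_update)
next
  case (step3 us d Z i j a b c a' b' c')
  then have "j \<notin> Z" "i \<noteq> j" "i < length us" "j < length us" by (simp_all add: cond3_def active_def)
  with step3 assms(2) show ?thesis by (auto simp: zeroed_def nth_list_update)
next
  case (step4 us d Z i j a b c a' b' c')
  then have "j \<notin> Z" "i \<noteq> j" "i < length us" "j < length us" by (simp_all add: cond4_def active_def)
  with step4 assms(2) show ?thesis by (auto simp: zeroed_def nth_list_update)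
qed

lemma reduction_invariants:
  assumes "reduction w (us, d, Z)"
  shows "net (us, d) = net w" and "zeroed (us, d, Z)" and "reduced (us, d, Z)"
proof -
  have "net (fst s', fst (snd s')) = net (fst s, fst (snd s)) \<and> zeroed s'"
    if "reduce_step\<^sup>*\<^sup>* s s'" "zeroed s" for s s'
    using that
  proof induction
    case (step s' s'')
    have "net (fst s'', fst (snd s'')) = net (fst s', fst (snd s'))"
      by (rule reduce_step_net[where Z = "snd (snd s')" and Z' = "snd (snd s'')"]) (use step.hyps in simp)
    moreover have "zeroed s''" using step reduce_step_zeroed by blast
    ultimately show ?case using step by simp
  qed simp
  from this[of "(fst w, snd w, {})" "(us, d, Z)"] assms
  show "net (us, d) = net w" "zeroed (us, d, Z)" "reduced (us, d, Z)"
    by (simp_all add: reduction_def zeroed_def)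
qed

section \<open>Stages 2 and 3: the normal form\<close>

text \<open>Distinctness is required of the nonzero units only, since the zero unit may be
  repeated.\<close>

definition normalised :: "hidden_unit list \<Rightarrow> bool" where
  "normalised us \<longleftrightarrow> (\<forall>(a, b, c)\<in>set us. (a, b, c) = (0, 0, 0) \<or> a \<noteq> 0 \<and> b > 0) \<and>
     distinct (map snd (filter (\<lambda>u. u \<noteq> (0, 0, 0)) us))"

text \<open>The order of the units is irrelevant, so the property survives sorting.\<close>

lemma normalised_mset:
  assumes "mset us = mset vs"
  shows "normalised us \<longleftrightarrow> normalised vs"
proof -
  have "set us = set vs" by (rule mset_eq_setD[OF assms])
  moreover have "distinct (map snd (filter P us)) \<longleftrightarrow> distinct (map snd (filter P vs))" for P
    by (rule mset_eq_imp_distinct_iff) (simp add: assms)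
  ultimately show ?thesis by (simp only: normalised_def)
qed

lemma net_mset: "mset us = mset vs \<Longrightarrow> net (us, d) = net (vs, d)"
  unfolding net_eq[abs_def] sum_mset_sum_list[symmetric] mset_map by simp

text \<open>In a reduced state the units outside \<open>Z\<close> have \<open>a\<close> and
  \<open>b\<close> nonzero, so \<open>sgn b\<close> is 1 or -1 and oddness of tanh applies. Two such
  units whose pairs \<open>(b, c)\<close> coincide after negation would have had equal or opposite
  pairs before, contradicting the failure of conditions (3) and (4).\<close>

lemma negation_properties:
  assumes "zeroed (us, d, Z)" and "reduced (us, d, Z)"
  shows "net (negation (us, d, Z)) = net (us, d)" and "normalised (fst (negation (us, d, Z)))"
proof -
  define n where "n = length us"
  define g where "g = (\<lambda>i. if i \<in> Z then us ! i
    else (case us ! i of (a, b, c) \<Rightarrow> (sgn b * a, sgn b * b, sgn b * c)))"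
  have neg: "negation (us, d, Z) = (map g [0..<n], d)"
    by (simp add: negation_def g_def n_def)
  have gZ: "us ! i = (0, 0, 0)" "g i = (0, 0, 0)" if "i < n" "i \<in> Z" for i
    using assms(1) that by (auto simp: zeroed_def g_def n_def)
  have act: "active (us, d, Z) i" if "i < n" "i \<notin> Z" for i
    using that by (simp add: active_def n_def)
  have nz: "a \<noteq> 0 \<and> b \<noteq> 0" if "i < n" "i \<notin> Z" "us ! i = (a, b, c)" for i a b c
    using assms(2) act[OF that(1,2)] that(3)
    by (auto simp: reduced_def cond1_def cond2_def)
  have gA: "g i = (sgn b * a, sgn b * b, sgn b * c)" if "i \<notin> Z" "us ! i = (a, b, c)" for i a b c
    using that by (simp add: g_def)
  have "unit_fun x (g i) = unit_fun x (us ! i)" if "i < n" for x i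
  proof (cases "i \<in> Z")
    case False
    obtain a b c where u: "us ! i = (a, b, c)" by (cases "us ! i")
    then show ?thesis
      using nz[OF that False u] gA[OF False u] unit_fun_uminus
      by (cases "b > 0") simp_all
  qed (use that gZ in simp)
  then have "map (unit_fun x) (map g [0..<n]) = map (unit_fun x) (map (\<lambda>i. us ! i) [0..<n])" for x
    by simp
  then have "map (unit_fun x) (map g [0..<n]) = map (unit_fun x) us" for x
    unfolding n_def map_nth .
  then show "net (negation (us, d, Z)) = net (us, d)"
    unfolding neg by (intro ext) (simp only: net_eq)
  have form: "g i = (0, 0, 0) \<or> fst (g i) \<noteq> 0 \<and> fst (snd (g i)) > 0" if "i < n" for i
  proof (cases "i \<in> Z")
    case False
    obtain a b c where u: "us ! i = (a, b, c)" by (cases "us ! i")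
    then show ?thesis
      using nz[OF that False u] gA[OF False u] by (auto simp: sgn_if)
  qed (use that gZ in simp)
  have "i = j" if ij: "i < n" "j < n" "g i \<noteq> (0, 0, 0)" "g j \<noteq> (0, 0, 0)" "snd (g i) = snd (g j)" for i j
  proof (rule ccontr)
    assume "i \<noteq> j"
    have Z: "i \<notin> Z" "j \<notin> Z" using ij gZ by auto
    obtain a b c where u: "us ! i = (a, b, c)" by (cases "us ! i")
    obtain a' b' c' where v: "us ! j = (a', b', c')" by (cases "us ! j")
    have "b \<noteq> 0" "b' \<noteq> 0" using nz[OF ij(1) Z(1) u] nz[OF ij(2) Z(2) v] by auto
    then have "(b, c) = (b', c') \<or> (b, c) = (- b', - c')"
      using ij(5) gA[OF Z(1) u] gA[OF Z(2) v] by (auto simp: sgn_if split: if_splits)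
    then have "cond3 (us, d, Z) i j \<or> cond4 (us, d, Z) i j"
      using act[OF ij(1) Z(1)] act[OF ij(2) Z(2)] \<open>i \<noteq> j\<close> u v by (auto simp: cond3_def cond4_def)
    then show False using assms(2) by (auto simp: reduced_def)
  qed
  then have "distinct (map snd (filter (\<lambda>u. u \<noteq> (0, 0, 0)) (map g [0..<n])))"
    by (simp add: filter_map distinct_map inj_on_def)
  with form show "normalised (fst (negation (us, d, Z)))"
    unfolding neg normalised_def fst_conv by (simp add: case_prod_beta prod_eq_iff)
qed

lemma sorting_properties:
  assumes "sorting w v"
  shows "mset (fst v) = mset (fst w)" "snd v = snd w" "sorted_wrt unit_ge (fst v)"
proof -
  obtain \<pi> where \<pi>: "\<pi> permutes {..<length (fst w)}"
    "\<forall>i j. i < j \<and> j < length (fst w) \<longrightarrow> unit_ge (fst w ! \<pi> i) (fst w ! \<pi> j)"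
    "v = (permute_list \<pi> (fst w), snd w)"
    using assms by (auto simp: sorting_def permute_list_def)
  then show "mset (fst v) = mset (fst w)" "snd v = snd w" "sorted_wrt unit_ge (fst v)"
    by (simp_all add: sorted_wrt_iff_nth_less permute_list_nth)
qed

text \<open>These properties do not mention the choices made in an execution; together with the
  length they determine the output from the function.\<close>

lemma canonicalise_properties:
  assumes "canonicalise w v"
  shows "net v = net w" "normalised (fst v)" "sorted_wrt unit_ge (fst v)"
proof -
  obtain us d Z where red: "reduction w (us, d, Z)" and sort: "sorting (negation (us, d, Z)) v"
    using assms by (auto simp: canonicalise_def)
  note neg = negation_properties[OF reduction_invariants(2,3)[OF red]]
  note srt = sorting_properties[OF sort]
  show "net v = net w"
    using net_mset[OF srt(1), of "snd v"] unfolding srt(2) prod.collapse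
    by (metis neg(1) prod.collapse reduction_invariants(1)[OF red] srt(2))
  show "normalised (fst v)" using normalised_mset[OF srt(1)] neg(2) by simp
  show "sorted_wrt unit_ge (fst v)" by (rule srt(3))
qed

section \<open>Uniqueness of the sorted normal form\<close>

text \<open>If the heads differed, each would occur in the tail of the other list, so they would be
  related both ways. Antisymmetry is assumed only on the entries because \<open>unit_ge\<close>
  ignores \<open>a\<close> and is not antisymmetric in general.\<close>

lemma sorted_wrt_mset_unique:
  assumes "mset xs = mset ys" "sorted_wrt R xs" "sorted_wrt R ys"
    and "\<And>x y. x \<in> set xs \<Longrightarrow> y \<in> set xs \<Longrightarrow> R x y \<Longrightarrow> R y x \<Longrightarrow> x = y"
  shows "xs = ys"
  using assms
proof (induction xs arbitrary: ys)
  case (Cons x xs)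
  from Cons.prems(1) obtain y ys' where ys: "ys = y # ys'" by (cases ys) simp_all
  have "insert x (set xs) = insert y (set ys')"
    using mset_eq_setD[OF Cons.prems(1)] unfolding ys list.set .
  then have "x = y \<or> x \<in> set ys' \<and> y \<in> set xs" by (metis insertE insertI1)
  then have xy: "x = y"
  proof
    assume *: "x \<in> set ys' \<and> y \<in> set xs"
    then have "R x y" "R y x" using Cons.prems(2,3) * unfolding ys sorted_wrt.simps by blast+
    with * show "x = y" by (intro Cons.prems(4)) simp_all
  qed
  have "xs = ys'"
    by (rule Cons.IH) (use Cons.prems(1-3) ys xy in simp_all, use Cons.prems(4) in auto)
  with ys xy show ?case by simp
qed simp

text \<open>Mutual comparison gives equal pairs \<open>(b, c)\<close>. The sign of \<open>b\<close>
  separates zero from nonzero units, and nonzero units have distinct pairs.\<close>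

lemma normalised_antisym:
  assumes "normalised us" "u \<in> set us" "v \<in> set us" "unit_ge u v" "unit_ge v u"
  shows "u = v"
proof -
  have "snd u = snd v"
    using assms(4,5) by (auto simp: unit_ge_def split: prod.splits)
  moreover have "w = (0, 0, 0) \<or> fst (snd w) > 0" if "w \<in> set us" for w
    using assms(1) that by (fastforce simp: normalised_def)
  moreover have "inj_on snd {u \<in> set us. u \<noteq> (0, 0, 0)}"
    using assms(1) by (simp add: normalised_def distinct_map)
  ultimately show ?thesis
    using assms(2,3) unfolding inj_on_def
    by (metis (mono_tags, lifting) fst_conv less_irrefl mem_Collect_eq snd_conv)
qed

text \<open>\<open>units_unique\<close> identifies the nonzero units as sets, hence as multisets
  because they are distinct; the equal lengths then fix the number of zero units.\<close>

lemma normalised_unique: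
  assumes us: "normalised us" and vs: "normalised vs"
    and len: "length us = length vs" and eq: "net (us, d) = net (vs, e)"
  shows "mset us = mset vs" "d = e"
proof -
  let ?nz = "\<lambda>u :: hidden_unit. u \<noteq> (0, 0, 0)"
  have dist: "distinct (filter ?nz ws)" if "normalised ws" for ws
    using that by (auto simp: normalised_def distinct_map)
  have net: "net (ws, k) x = k + (\<Sum>u\<in>set (filter ?nz ws). unit_fun x u)" if "normalised ws" for ws k x
  proof -
    have "sum_list (map (unit_fun x) ws) = sum_list (map (unit_fun x) (filter ?nz ws))"
      by (rule sum_list_map_filter[symmetric]) (auto simp: unit_fun_zero)
    then show ?thesis
      using dist[OF that] by (simp add: net_eq sum_list_distinct_conv_sum_set del: set_filter)
  qed
  have set: "set (filter ?nz us) = set (filter ?nz vs)"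
  proof (rule units_unique[where d = d and e = e])
    show "d + (\<Sum>u\<in>set (filter ?nz us). unit_fun x u) = e + (\<Sum>u\<in>set (filter ?nz vs). unit_fun x u)" for x
      using net[OF us, of d x] net[OF vs, of e x] eq by simp
  qed (use us vs in \<open>auto simp: normalised_def distinct_map\<close>)
  \<comment> \<open>With equal sets of nonzero units, evaluating at the single point 0 cancels the
    sums.\<close>
  then show "d = e" using net[OF us, of d 0] net[OF vs, of e 0] eq by simp
  have nonzero: "filter_mset ?nz (mset us) = filter_mset ?nz (mset vs)"
    using set dist[OF us] dist[OF vs] by (metis mset_filter set_eq_iff_mset_eq_distinct)
  have zeros: "filter_mset (\<lambda>u. \<not> ?nz u) (mset ws) = replicate_mset (length ws - size (filter_mset ?nz (mset ws))) (0, 0, 0)" for ws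
  proof -
    have "size (mset ws) = size (filter_mset ?nz (mset ws)) + size (filter_mset (\<lambda>u. \<not> ?nz u) (mset ws))"
      by (subst multiset_partition[of "mset ws" ?nz]) (rule size_union)
    moreover have "filter_mset (\<lambda>u. \<not> ?nz u) M = replicate_mset (size (filter_mset (\<lambda>u. \<not> ?nz u) M)) (0, 0, 0)" for M
      by (induction M) auto
    ultimately show ?thesis by (metis add_diff_cancel_left' size_mset)
  qed
  have "filter_mset (\<lambda>u. \<not> ?nz u) (mset us) = filter_mset (\<lambda>u. \<not> ?nz u) (mset vs)"
    using zeros[of us] zeros[of vs] unfolding nonzero len by (rule trans[OF _ sym])
  with nonzero show "mset us = mset vs" by (metis multiset_partition)
qed

theorem theorem4p2:
  fixes h :: nat and w w' v v' :: param
  assumes "w \<in> params h" and "w' \<in> params h"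
    and "canonicalise w v" and "canonicalise w' v'"
  shows "functionally_equivalent v w \<and> (functionally_equivalent w w' \<longrightarrow> v = v')"
proof (intro conjI impI)
  note p = canonicalise_properties[OF assms(3)] and p' = canonicalise_properties[OF assms(4)]
  show "functionally_equivalent v w" using p(1) by (simp add: functionally_equivalent_def)
  assume "functionally_equivalent w w'"
  then have "net (fst v, snd v) = net (fst v', snd v')"
    unfolding prod.collapse p(1) p'(1) by (intro ext) (simp add: functionally_equivalent_def)
  moreover have "length (fst v) = length (fst v')"
    using canonicalise_params[OF assms(1,3)] canonicalise_params[OF assms(2,4)]
    by (simp add: params_def)
  ultimately have "mset (fst v) = mset (fst v')" "snd v = snd v'"
    using normalised_unique[OF p(2) p'(2)] by blast+
  moreover from this(1) have "fst v = fst v'"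
    using sorted_wrt_mset_unique[OF _ p(3) p'(3)] normalised_antisym[OF p(2)] by blast
  ultimately show "v = v'" by (simp add: prod_eq_iff)
qed

end
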